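(* Let $F$ be a simple graph of order $n\ge 1$, let $V_k=\{v_1,\ldots,v_k\}\subseteq V(F)$ with $|V_k|=k$, and let $H_v$ be a simple graph of order $m\ge 2$ with a specified vertex $v$ of degree $m-1$. Put $H_1=H_v-v$ and $G=G[F,V_k,H_v]$. Order the vertices of $F$ so that $v_1,\ldots,v_k$ come first. Then the characteristic polynomial of the signless Laplacian matrix of $G$ is $$f_{Q(G)}(x)=\bigl(f_{Q(H_1)}(x-1)\bigr)^k\det(xI_n-M),\qquad M=Q(F)+\bigl(m-1+\Gamma_{Q(H_1)}(x-1)\bigr)\begin{pmatrix} I_k & 0\\ 0&0\end{pmatrix},$$ where the block matrix is $n\times n$.
   Context: All graphs are finite and simple. For a graph $X$, $Q(X)=D(X)+A(X)$ is the signless Laplacian matrix, where $D(X)$ is the diagonal matrix of degrees and $A(X)$ the adjacency matrix. For a square matrix $N$ of order $s$, $f_N(x)=\det(xI_s-N)$ is its characteristic polynomial, and its coronal is $\Gamma_N(x)=\mathbf 1_s^T(xI_s-N)^{-1}\mathbf 1_s$, a rational function of $x$, where $\mathbf 1_s$ is the all-ones column vector; the identity is an identity of rational functions in $x$. Graph with $k$ pockets: $G[F,V_k,H_v]$ is obtained by taking one copy of $F$ and $k$ vertex-disjoint copies of $H_v$, and, for each $i=1,\ldots,k$, identifying the vertex $v$ of the $i$th copy of $H_v$ with the vertex $v_i$ of $F$. *)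

theory Defs
  imports
    "Graph_Theory.Pair_Digraph"
    "Jordan_Normal_Form.Char_Poly"
    "Jordan_Normal_Form.Gauss_Jordan_Elimination"
    "HOL-Computational_Algebra.Field_as_Ring"
    "HOL-Computational_Algebra.Polynomial_Factorial"
begin

section \<open>Signless Laplacian matrices\<close>

text \<open>
  Finite simple graphs are the finite, symmetric, loop-free digraphs of
  \<^locale>\<open>pair_graph\<close>: an edge \<open>{u, w}\<close> is the pair of arcs \<open>(u, w)\<close>, \<open>(w, u)\<close>,
  so the degree of a vertex is its \<^const>\<open>out_degree\<close>.
  Matrices are indexed by numbers, so a matrix of a graph is taken with respect to a
  list that enumerates the vertices without repetition.
\<close>

definition vertex_order :: "('a, 'b) pre_digraph \<Rightarrow> 'a list \<Rightarrow> bool" where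
  "vertex_order X xs \<longleftrightarrow> distinct xs \<and> set xs = verts X"

definition adjacency_matrix :: "('a, 'b) pre_digraph \<Rightarrow> 'a list \<Rightarrow> real mat" where
  "adjacency_matrix X xs = mat (length xs) (length xs)
     (\<lambda>(i, j). if xs ! i \<rightarrow>\<^bsub>X\<^esub> xs ! j then 1 else 0)"

definition degree_matrix :: "('a, 'b) pre_digraph \<Rightarrow> 'a list \<Rightarrow> real mat" where
  "degree_matrix X xs = mat (length xs) (length xs)
     (\<lambda>(i, j). if i = j then real (out_degree X (xs ! i)) else 0)"

definition signless_laplacian :: "('a, 'b) pre_digraph \<Rightarrow> 'a list \<Rightarrow> real mat" where
  "signless_laplacian X xs = degree_matrix X xs + adjacency_matrix X xs"

section \<open>Rational functions and coronals\<close>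

text \<open>The field of rational functions over the reals is \<^typ>\<open>real poly fract\<close>.\<close>

abbreviation ratfun_X :: "real poly fract" where
  "ratfun_X \<equiv> to_fract [:0, 1:]"

definition ratfun_mat :: "real mat \<Rightarrow> real poly fract mat" where
  "ratfun_mat = map_mat (\<lambda>c. to_fract [:c:])"

text \<open>
  Substitution of a polynomial \<open>p\<close> for the variable of a rational function. It is
  meaningful for nonconstant \<open>p\<close>, where the denominator cannot become zero.
\<close>

definition ratfun_subst :: "real poly fract \<Rightarrow> real poly \<Rightarrow> real poly fract" where
  "ratfun_subst r p = (case quot_of_fract r of
     (a, b) \<Rightarrow> to_fract (a \<circ>\<^sub>p p) / to_fract (b \<circ>\<^sub>p p))"

lemma ratfun_subst_Fract:
  assumes "b \<noteq> 0" and "degree p > 0"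
  shows "ratfun_subst (Fract a b) p = to_fract (a \<circ>\<^sub>p p) / to_fract (b \<circ>\<^sub>p p)"
proof -
  obtain c d where cd: "quot_of_fract (Fract a b) = (c, d)" by fastforce
  have d: "d \<noteq> 0" using snd_quot_of_fract_nonzero[of "Fract a b"] cd by simp
  have "Fract c d = Fract a b"
    using Fract_quot_of_fract[of "Fract a b"] cd by simp
  hence "c * b = a * d" using d assms by (simp add: eq_fract)
  hence *: "(c \<circ>\<^sub>p p) * (b \<circ>\<^sub>p p) = (a \<circ>\<^sub>p p) * (d \<circ>\<^sub>p p)"
    by (metis pcompose_mult)
  have nz: "q \<circ>\<^sub>p p \<noteq> 0" if "q \<noteq> 0" for q
    using that assms(2) pcompose_eq_0 by blast
  have "to_fract (c \<circ>\<^sub>p p) * to_fract (b \<circ>\<^sub>p p) = to_fract (a \<circ>\<^sub>p p) * to_fract (d \<circ>\<^sub>p p)"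
    by (metis * to_fract_mult)
  with nz[OF d] nz[OF assms(1)] show ?thesis
    by (simp add: ratfun_subst_def cd frac_eq_eq)
qed

text \<open>
  \<open>\<Gamma>\<^sub>N(x) = 1\<^sup>T (x I - N)\<^sup>-\<^sup>1 1\<close>. The matrix \<open>x I - N\<close> is always invertible over
  the field of rational functions, so \<^const>\<open>mat_inverse\<close> returns its inverse; see
  \<open>mat_inverse_char\<close> below.
\<close>

definition coronal :: "real mat \<Rightarrow> real poly fract" where
  "coronal N = (let s = dim_row N; one = vec s (\<lambda>_. 1);
      R = the (mat_inverse (ratfun_X \<cdot>\<^sub>m 1\<^sub>m s - ratfun_mat N))
    in one \<bullet> (R *\<^sub>v one))"

lemma mat_inverse_char:
  assumes N: "N \<in> carrier_mat s s"
  defines "B \<equiv> ratfun_X \<cdot>\<^sub>m 1\<^sub>m s - ratfun_mat N"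
  shows "\<exists>R. mat_inverse B = Some R \<and> R \<in> carrier_mat s s \<and> B * R = 1\<^sub>m s \<and> R * B = 1\<^sub>m s"
proof -
  interpret to_fract_hom: comm_ring_hom "to_fract :: real poly \<Rightarrow> real poly fract"
    by unfold_locales simp_all
  have B: "B \<in> carrier_mat s s" using N by (auto simp: B_def ratfun_mat_def)
  have "B = map_mat to_fract (char_poly_matrix N)"
    using N by (intro eq_matI)
      (auto simp: B_def ratfun_mat_def char_poly_matrix_def
            simp flip: to_fract_diff to_fract_uminus)
  hence "det B = to_fract (char_poly N)"
    by (simp add: char_poly_def to_fract_hom.hom_det)
  moreover have "char_poly N \<noteq> 0"
    using degree_monic_char_poly[OF N] by auto
  ultimately have "det B \<noteq> 0" by simp
  hence "B \<in> Units (ring_mat TYPE(real poly fract) s ())"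
    using B by (rule det_non_zero_imp_unit[rotated])
  with mat_inverse(1)[OF B, of "()"] obtain R where "mat_inverse B = Some R"
    by (cases "mat_inverse B") simp_all
  with mat_inverse(2)[OF B this] show ?thesis by simp
qed

section \<open>Graphs with pockets\<close>

text \<open>
  \<open>pocket_embed ps v i\<close> maps the vertices of the \<open>i\<close>-th copy of \<open>H\<close> (copies numbered
  from \<open>0\<close>) into the graph with pockets: \<open>v\<close> is identified with the vertex \<open>ps ! i\<close> of \<open>F\<close>,
  all other vertices stay disjoint from \<open>F\<close> and from the other copies.
\<close>

definition pocket_embed :: "'a list \<Rightarrow> 'b \<Rightarrow> nat \<Rightarrow> 'b \<Rightarrow> 'a + nat \<times> 'b" where
  "pocket_embed ps v i w = (if w = v then Inl (ps ! i) else Inr (i, w))"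

definition pocket_graph ::
  "'a pair_pre_digraph \<Rightarrow> 'a list \<Rightarrow> 'b pair_pre_digraph \<Rightarrow> 'b \<Rightarrow> ('a + nat \<times> 'b) pair_pre_digraph"
where
  "pocket_graph F ps H v =
     \<lparr> pverts = Inl ` pverts F \<union> (\<Union>i<length ps. pocket_embed ps v i ` pverts H),
       parcs = map_prod Inl Inl ` parcs F \<union>
         (\<Union>i<length ps. map_prod (pocket_embed ps v i) (pocket_embed ps v i) ` parcs H) \<rparr>"

lemma pair_graph_pocket_graph:
  assumes "pair_graph F" and "pair_graph H"
  shows "pair_graph (pocket_graph F ps H v)"
proof -
  interpret F: pair_graph F by fact
  interpret H: pair_graph H by fact
  have symF: "(y, x) \<in> parcs F" if "(x, y) \<in> parcs F" for x y
    using F.pair_sym_arcs that by (auto simp: symmetric_def dest: symD)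
  have symH: "(y, x) \<in> parcs H" if "(x, y) \<in> parcs H" for x y
    using H.pair_sym_arcs that by (auto simp: symmetric_def dest: symD)
  have inj: "x = y" if "pocket_embed ps v i x = pocket_embed ps v i y" for i x y
    using that by (auto simp: pocket_embed_def split: if_splits)
  let ?G = "pocket_graph F ps H v"
  have sym: "sym (parcs ?G)"
  proof (rule symI)
    fix x y assume "(x, y) \<in> parcs ?G"
    then consider a b where "(a, b) \<in> parcs F" "x = Inl a" "y = Inl b"
      | i a b where "i < length ps" "(a, b) \<in> parcs H"
          "x = pocket_embed ps v i a" "y = pocket_embed ps v i b"
      by (auto simp: pocket_graph_def)
    thus "(y, x) \<in> parcs ?G"
    proof cases
      case 1 with symF show ?thesis by (force simp: pocket_graph_def)
    next
      case (2 i a b)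
      hence "(y, x) \<in> map_prod (pocket_embed ps v i) (pocket_embed ps v i) ` parcs H"
        using symH by force
      with 2(1) show ?thesis unfolding pocket_graph_def pair_pre_digraph.simps by blast
    qed
  qed
  show ?thesis
  proof
    fix e assume "e \<in> parcs ?G"
    then consider a b where "(a, b) \<in> parcs F" "e = (Inl a, Inl b)"
      | i a b where "i < length ps" "(a, b) \<in> parcs H"
          "e = (pocket_embed ps v i a, pocket_embed ps v i b)"
      by (auto simp: pocket_graph_def)
    hence "fst e \<in> pverts ?G \<and> snd e \<in> pverts ?G \<and> fst e \<noteq> snd e"
    proof cases
      case 1
      with F.wellformed' F.pair_no_loops[of "(a, b)" for a b] show ?thesis
        by (fastforce simp: pocket_graph_def)
    next
      case (2 i a b)
      have "a \<in> pverts H" "b \<in> pverts H" "a \<noteq> b"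
        using 2(2) H.wellformed' H.pair_no_loops[of "(a, b)"] by auto
      with 2(1,3) inj[of i a b] show ?thesis
        unfolding pocket_graph_def by auto
    qed
    thus "fst e \<in> pverts ?G" and "snd e \<in> pverts ?G" and "fst e \<noteq> snd e" by auto
  next
    show "finite (pverts ?G)" and "finite (parcs ?G)"
      by (auto simp: pocket_graph_def)
    show "symmetric (with_proj ?G)" using sym by (simp add: symmetric_def)
  qed
qed

end

theory Submission
  imports Defs
begin

text \<open>
  List the vertices of \<open>F\<close> first and then, copy by copy, those of \<open>H\<^sub>1\<close>. As \<open>v\<close> is
  adjacent to every other vertex of \<open>H\<close>, each copy contributes to \<open>x I - Q(G)\<close> a
  diagonal block \<open>E = (x - 1) I - Q(H\<^sub>1)\<close>, joined to the rest only by entries \<open>- 1\<close> in the row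
  and column of its vertex \<open>v\<^sub>i\<close>. Taking the Schur complement of the last copy splits off
  \<open>det E = f\<^bsub>Q(H\<^sub>1)\<^esub>(x - 1)\<close> and subtracts \<open>1\<^sup>T E\<^sup>-\<^sup>1 1 = \<Gamma>\<^bsub>Q(H\<^sub>1)\<^esub>(x - 1)\<close> from the diagonal
  entry of \<open>v\<^sub>i\<close>, so the formula follows by induction on the number of pockets.
\<close>

section \<open>Matrices indexed by lists of vertices\<close>

text \<open>Entries depend on the vertices and not on their positions, so reordering vertices or
  splitting off a copy of \<open>H\<close> becomes an operation on lists.\<close>

definition kernel_mat :: "('a \<Rightarrow> 'a \<Rightarrow> 'b) \<Rightarrow> 'a list \<Rightarrow> 'a list \<Rightarrow> 'b mat" where
  "kernel_mat f xs ys = mat (length xs) (length ys) (\<lambda>(i, j). f (xs ! i) (ys ! j))"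

lemma kernel_mat_carrier [simp]: "kernel_mat f xs ys \<in> carrier_mat (length xs) (length ys)"
  by (simp add: kernel_mat_def)

lemma dim_kernel_mat [simp]:
  "dim_row (kernel_mat f xs ys) = length xs" "dim_col (kernel_mat f xs ys) = length ys"
  by (simp_all add: kernel_mat_def)

lemma index_kernel_mat [simp]:
  "i < length xs \<Longrightarrow> j < length ys \<Longrightarrow> kernel_mat f xs ys $$ (i, j) = f (xs ! i) (ys ! j)"
  by (simp add: kernel_mat_def)

lemma kernel_mat_cong:
  assumes "\<And>x y. x \<in> set xs \<Longrightarrow> y \<in> set ys \<Longrightarrow> f x y = g x y"
  shows "kernel_mat f xs ys = kernel_mat g xs ys"
  by (rule eq_matI) (auto simp: assms)

lemma kernel_mat_map: "kernel_mat f (map g xs) (map h ys) = kernel_mat (\<lambda>x y. f (g x) (h y)) xs ys"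
  by (rule eq_matI) auto

lemma kernel_mat_append:
  "kernel_mat f (xs @ ys) (xs @ ys) = four_block_mat
     (kernel_mat f xs xs) (kernel_mat f xs ys) (kernel_mat f ys xs) (kernel_mat f ys ys)"
  by (rule eq_matI) (auto simp: nth_append)

text \<open>Reordering the list permutes rows and columns alike; the sign enters twice and squares
  to 1. Hence the given enumeration of a graph can be replaced by a convenient one.\<close>

lemma det_kernel_mat_mset_cong:
  fixes f :: "'a \<Rightarrow> 'a \<Rightarrow> 'b :: comm_ring_1"
  assumes "mset xs = mset ys"
  shows "det (kernel_mat f xs xs) = det (kernel_mat f ys ys)"
proof -
  define n where "n = length ys"
  have n: "length xs = n" using assms n_def by (metis size_mset)
  obtain p where p: "p permutes {..<length ys}" "permute_list p ys = xs"
    using assms by (rule mset_eq_permutation)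
  hence pn: "p permutes {0..<n}" by (simp add: n_def atLeast0LessThan)
  have nth: "xs ! i = ys ! p i" if "i < n" for i
    using permute_list_nth[OF p(1), of i] that p(2) by (simp add: n_def)
  have less: "p i < n" if "i < n" for i
    using permutes_in_image[OF pn, of i] that by simp
  define A where "A = kernel_mat f ys ys"
  have A: "A \<in> carrier_mat n n" by (simp add: A_def n_def carrier_matI)
  \<comment> \<open>\<open>B\<close> permutes the rows of \<open>A\<close>; \<open>C\<close> then
    permutes the rows of the transpose of \<open>B\<close>, that is, its columns.\<close>
  define B where "B = mat n n (\<lambda>(i, j). A $$ (p i, j))"
  have B: "B \<in> carrier_mat n n" by (simp add: B_def)
  define C where "C = mat n n (\<lambda>(i, j). B\<^sup>T $$ (p i, j))"
  have C: "C \<in> carrier_mat n n" by (simp add: C_def)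
  have sgn: "signof p * signof p = (1 :: 'b)"
    by (simp add: sign_def)
  have "kernel_mat f xs xs = C\<^sup>T"
    by (rule eq_matI) (auto simp: C_def B_def A_def n nth less simp flip: n_def)
  hence "det (kernel_mat f xs xs) = det C" using det_transpose[OF C] by simp
  also have "\<dots> = signof p * det B\<^sup>T"
    unfolding C_def by (rule det_permute_rows[OF _ pn]) (use B in simp)
  also have "\<dots> = signof p * (signof p * det A)"
    unfolding det_transpose[OF B] unfolding B_def det_permute_rows[OF A pn] ..
  also have "\<dots> = det A" by (simp add: sgn mult.assoc[symmetric])
  finally show ?thesis by (simp add: A_def)
qed

section \<open>Schur complements and determinants of pocket-shaped matrices\<close>

text \<open>A block column operation of determinant 1 makes the matrix block triangular. The inverse
  of \<open>D\<close> is supplied as a matrix \<open>R\<close>, which keeps the statement free of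
  division.\<close>

lemma det_schur_complement:
  fixes A :: "'a :: idom mat"
  assumes A: "A \<in> carrier_mat n n" and B: "B \<in> carrier_mat n m"
    and C: "C \<in> carrier_mat m n" and D: "D \<in> carrier_mat m m"
    and R: "R \<in> carrier_mat m m" and DR: "D * R = 1\<^sub>m m"
  shows "det (four_block_mat A B C D) = det D * det (A - B * R * C)"
proof -
  \<comment> \<open>Multiplication by \<open>?U\<close> subtracts the second block column times
    \<open>R * C\<close> from the first; the lower left block becomes
    \<open>C - D * R * C = 0\<close>.\<close>
  let ?U = "four_block_mat (1\<^sub>m n) (0\<^sub>m n m) (- (R * C)) (1\<^sub>m m)"
  have RC: "R * C \<in> carrier_mat m n" using R C by simp
  have "four_block_mat A B C D * ?U = four_block_mat (A - B * R * C) B (0\<^sub>m m n) D"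
  proof -
    have "A * 1\<^sub>m n + B * (- (R * C)) = A - B * R * C"
      using A B R C RC by (auto simp: assoc_mult_mat[OF B R C] minus_add_uminus_mat[of A n n])
    moreover have "A * 0\<^sub>m n m + B * 1\<^sub>m m = B" and "C * 0\<^sub>m n m + D * 1\<^sub>m m = D"
      using A B C D by simp_all
    moreover have "D * (- (R * C)) = - C"
      using D R C by (simp add: assoc_mult_mat[OF D R C, symmetric] DR)
    hence "C * 1\<^sub>m n + D * (- (R * C)) = 0\<^sub>m m n"
      using C by (intro eq_matI) auto
    moreover have "four_block_mat A B C D * ?U = four_block_mat
        (A * 1\<^sub>m n + B * (- (R * C))) (A * 0\<^sub>m n m + B * 1\<^sub>m m)
        (C * 1\<^sub>m n + D * (- (R * C))) (C * 0\<^sub>m n m + D * 1\<^sub>m m)"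
      by (rule mult_four_block_mat[OF A B C D]) (use RC in auto)
    ultimately show ?thesis by (simp only:)
  qed
  moreover have "det ?U = 1"
    by (subst det_four_block_mat_upper_right_zero[of _ n _ m]) (use RC in auto)
  moreover have "det (four_block_mat A B C D * ?U) = det (four_block_mat A B C D) * det ?U"
    by (rule det_mult[of _ "n + m"]) (use A D RC in auto)
  moreover have "det (four_block_mat (A - B * R * C) B (0\<^sub>m m n) D) = det (A - B * R * C) * det D"
    by (rule det_four_block_mat_lower_left_zero[of _ n _ m]) (use A B C D R in auto)
  ultimately show ?thesis by (simp add: mult.commute)
qed

text \<open>The outer factors are multiples of all-ones rows and columns, so the product has rank at
  most one and only the sum of all entries of \<open>R\<close> survives, which is the form of a
  coronal.\<close>

lemma constant_rows_mult_constant_cols: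
  fixes R :: "'a :: comm_semiring_1 mat"
  assumes R: "R \<in> carrier_mat s s"
  shows "mat n s (\<lambda>(i, j). b i) * R * mat s m (\<lambda>(i, j). c j)
       = mat n m (\<lambda>(i, j). b i * c j * (vec s (\<lambda>_. 1) \<bullet> (R *\<^sub>v vec s (\<lambda>_. 1))))"
proof (rule eq_matI)
  let ?B = "mat n s (\<lambda>(i, j). b i)" and ?C = "mat s m (\<lambda>(i, j). c j)"
  fix i j assume "i < dim_row (mat n m (\<lambda>(i, j). b i * c j * (vec s (\<lambda>_. 1) \<bullet> (R *\<^sub>v vec s (\<lambda>_. 1)))))"
    "j < dim_col (mat n m (\<lambda>(i, j). b i * c j * (vec s (\<lambda>_. 1) \<bullet> (R *\<^sub>v vec s (\<lambda>_. 1)))))"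
  hence ij: "i < n" "j < m" by auto
  have "(?B * R * ?C) $$ (i, j) = (\<Sum>l<s. (\<Sum>l'<s. b i * R $$ (l', l)) * c j)"
    using ij R by (simp add: scalar_prod_def atLeast0LessThan)
  also have "\<dots> = (\<Sum>l<s. \<Sum>l'<s. b i * c j * R $$ (l', l))"
    by (simp add: sum_distrib_right sum_distrib_left mult_ac)
  \<comment> \<open>The matrix product sums over the column index of \<open>R\<close> outside, the
    scalar product over the row index.\<close>
  also have "\<dots> = (\<Sum>l'<s. \<Sum>l<s. b i * c j * R $$ (l', l))"
    by (rule sum.swap)
  also have "\<dots> = b i * c j * (vec s (\<lambda>_. 1) \<bullet> (R *\<^sub>v vec s (\<lambda>_. 1)))"
    using R by (simp add: scalar_prod_def atLeast0LessThan sum_distrib_left)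
  finally show "(?B * R * ?C) $$ (i, j) = mat n m (\<lambda>(i, j). b i * c j * (vec s (\<lambda>_. 1) \<bullet> (R *\<^sub>v vec s (\<lambda>_. 1)))) $$ (i, j)"
    using ij by simp
qed (use R in auto)

text \<open>
  With \<open>\<alpha>\<close> and \<open>\<beta>\<close> the entries on the base graph and on one copy, this is the shape of
  \<open>x I - Q(G)\<close>; copy \<open>i\<close> hangs at the vertex \<open>p i\<close>.
\<close>

fun pocket_kernel :: "('a \<Rightarrow> 'a \<Rightarrow> 'c) \<Rightarrow> ('b \<Rightarrow> 'b \<Rightarrow> 'c) \<Rightarrow> (nat \<Rightarrow> 'a) \<Rightarrow>
    'a + nat \<times> 'b \<Rightarrow> 'a + nat \<times> 'b \<Rightarrow> 'c :: ring_1" where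
  "pocket_kernel \<alpha> \<beta> p (Inl a) (Inl b) = \<alpha> a b"
| "pocket_kernel \<alpha> \<beta> p (Inl a) (Inr (j, w)) = (if a = p j then - 1 else 0)"
| "pocket_kernel \<alpha> \<beta> p (Inr (i, u)) (Inl b) = (if b = p i then - 1 else 0)"
| "pocket_kernel \<alpha> \<beta> p (Inr (i, u)) (Inr (j, w)) = (if i = j then \<beta> u w else 0)"

text \<open>The newest copy comes last, so the recursion on \<open>k\<close> matches the split in
  \<open>kernel_mat_append\<close> with that copy in the lower right block.\<close>

fun pocket_order :: "'a list \<Rightarrow> 'b list \<Rightarrow> nat \<Rightarrow> ('a + nat \<times> 'b) list" where
  "pocket_order fs hs 0 = map Inl fs"
| "pocket_order fs hs (Suc k) = pocket_order fs hs k @ map (\<lambda>w. Inr (k, w)) hs"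

lemma set_pocket_order:
  "set (pocket_order fs hs k) = Inl ` set fs \<union> Inr ` ({..<k} \<times> set hs)"
  by (induction k) (auto simp: less_Suc_eq)

lemma distinct_pocket_order:
  "distinct fs \<Longrightarrow> distinct hs \<Longrightarrow> distinct (pocket_order fs hs k)"
  by (induction k) (auto simp: set_pocket_order distinct_map inj_on_def)

text \<open>Induction on \<open>k\<close> by the Schur complement of the last copy. What remains has
  the same shape with fewer copies and other base entries, which is why \<open>\<alpha>\<close> is
  generalised.\<close>

lemma det_pocket_kernel:
  fixes \<alpha> :: "'a \<Rightarrow> 'a \<Rightarrow> 'c :: idom" and hs :: "'b list"
  defines "u \<equiv> vec (length hs) (\<lambda>_. 1 :: 'c)"
  assumes R: "R \<in> carrier_mat (length hs) (length hs)"
    and inv: "kernel_mat \<beta> hs hs * R = 1\<^sub>m (length hs)"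
  shows "det (kernel_mat (pocket_kernel \<alpha> \<beta> p) (pocket_order fs hs k) (pocket_order fs hs k))
       = det (kernel_mat \<beta> hs hs) ^ k *
         det (kernel_mat (\<lambda>a b. \<alpha> a b - (\<Sum>i<k. if a = p i \<and> b = p i then u \<bullet> (R *\<^sub>v u) else 0)) fs fs)"
proof (induction k arbitrary: \<alpha>)
  case 0
  show ?case by (simp add: kernel_mat_map)
next
  case (Suc k)
  let ?f = "pocket_kernel \<alpha> \<beta> p" and ?o = "pocket_order fs hs k" and ?c = "map (\<lambda>w. Inr (k, w)) hs"
  let ?g = "u \<bullet> (R *\<^sub>v u)"
  \<comment> \<open>The base entries after removing copy \<open>k\<close>: only the diagonal entry
    of its attachment vertex changes.\<close>
  define \<alpha>' where "\<alpha>' a b = \<alpha> a b - (if a = p k \<and> b = p k then ?g else 0)" for a b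
  \<comment> \<open>The entry joining position \<open>i\<close> to any vertex of copy
    \<open>k\<close>. It is the same for all vertices of that copy, so both coupling blocks have
    rank at most one.\<close>
  define d where "d i = (if ?o ! i = Inl (p k) then - 1 else 0 :: 'c)" for i
  have cases: "(\<exists>a. ?o ! i = Inl a) \<or> (\<exists>j<k. \<exists>w. ?o ! i = Inr (j, w))" if "i < length ?o" for i
    using nth_mem[OF that] by (auto simp: set_pocket_order)
  have B: "kernel_mat ?f ?o ?c = mat (length ?o) (length hs) (\<lambda>(i, j). d i)"
  proof (rule eq_matI)
    fix i j assume "i < dim_row (mat (length ?o) (length hs) (\<lambda>(i, j). d i))"
      "j < dim_col (mat (length ?o) (length hs) (\<lambda>(i, j). d i))"
    with cases[of i] show "kernel_mat ?f ?o ?c $$ (i, j) = mat (length ?o) (length hs) (\<lambda>(i, j). d i) $$ (i, j)"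
      by (auto simp: d_def)
  qed auto
  have C: "kernel_mat ?f ?c ?o = mat (length hs) (length ?o) (\<lambda>(i, j). d j)"
  proof (rule eq_matI)
    fix i j assume "i < dim_row (mat (length hs) (length ?o) (\<lambda>(i, j). d j))"
      "j < dim_col (mat (length hs) (length ?o) (\<lambda>(i, j). d j))"
    with cases[of j] show "kernel_mat ?f ?c ?o $$ (i, j) = mat (length hs) (length ?o) (\<lambda>(i, j). d j) $$ (i, j)"
      by (auto simp: d_def)
  qed auto
  have D: "kernel_mat ?f ?c ?c = kernel_mat \<beta> hs hs"
    by (simp add: kernel_mat_map)
  have "kernel_mat ?f ?o ?o - kernel_mat ?f ?o ?c * R * kernel_mat ?f ?c ?o
      = kernel_mat (pocket_kernel \<alpha>' \<beta> p) ?o ?o" (is "?L = _")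
  proof (rule eq_matI)
    fix i j assume "i < dim_row (kernel_mat (pocket_kernel \<alpha>' \<beta> p) ?o ?o)"
      "j < dim_col (kernel_mat (pocket_kernel \<alpha>' \<beta> p) ?o ?o)"
    hence ij: "i < length ?o" "j < length ?o" by auto
    hence "?L $$ (i, j) = ?f (?o ! i) (?o ! j) - d i * d j * ?g"
      unfolding B C constant_rows_mult_constant_cols[OF R] by (simp add: u_def)
    \<comment> \<open>\<open>d\<close> vanishes on the earlier copies, and the signs cancel in
      \<open>d i * d j\<close>, so the correction is \<open>?g\<close> exactly at the vertex
      \<open>p k\<close>.\<close>
    also have "\<dots> = pocket_kernel \<alpha>' \<beta> p (?o ! i) (?o ! j)"
      using cases[OF ij(1)] cases[OF ij(2)] by (auto simp: d_def \<alpha>'_def)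
    finally show "?L $$ (i, j) = kernel_mat (pocket_kernel \<alpha>' \<beta> p) ?o ?o $$ (i, j)"
      using ij by simp
  qed (auto simp: B C R)
  moreover have "det (kernel_mat ?f (pocket_order fs hs (Suc k)) (pocket_order fs hs (Suc k)))
      = det (kernel_mat \<beta> hs hs) * det ?L"
    unfolding pocket_order.simps kernel_mat_append D
    by (rule det_schur_complement[OF _ _ _ _ R inv]) (auto simp: carrier_matI)
  moreover have "(\<lambda>a b. \<alpha>' a b - (\<Sum>i<k. if a = p i \<and> b = p i then ?g else 0))
      = (\<lambda>a b. \<alpha> a b - (\<Sum>i<Suc k. if a = p i \<and> b = p i then ?g else 0))"
    by (auto simp: \<alpha>'_def fun_eq_iff)
  ultimately show ?case
    by (simp only: Suc.IH[of \<alpha>'] power_Suc mult.assoc)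
qed

section \<open>Substitution in rational functions and shifted coronals\<close>

lemma comm_ring_hom_to_fract: "comm_ring_hom (to_fract :: 'a :: idom \<Rightarrow> 'a fract)"
  by unfold_locales simp_all

lemma ratfun_subst_to_fract: "ratfun_subst (to_fract a) q = to_fract (a \<circ>\<^sub>p q)"
  by (simp add: ratfun_subst_def)

text \<open>A nonconstant \<open>q\<close> keeps denominators nonzero, so sums and products of
  fractions can be computed on representatives. As a homomorphism, substitution commutes with
  determinants and matrix products.\<close>

lemma comm_ring_hom_ratfun_subst:
  assumes q: "degree q > 0"
  shows "comm_ring_hom (\<lambda>r. ratfun_subst r q)"
proof
  have nz: "b \<circ>\<^sub>p q \<noteq> 0" if "b \<noteq> 0" for b :: "real poly"
    using that q pcompose_eq_0 by blast
  fix x y :: "real poly fract"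
  obtain a b where x: "x = Fract a b" and b: "b \<noteq> 0" by (cases x)
  obtain c d where y: "y = Fract c d" and d: "d \<noteq> 0" by (cases y)
  show "ratfun_subst (x + y) q = ratfun_subst x q + ratfun_subst y q"
    using b d nz[OF b] nz[OF d]
    by (simp add: x y ratfun_subst_Fract q pcompose_mult pcompose_add add_frac_eq)
  show "ratfun_subst (x * y) q = ratfun_subst x q * ratfun_subst y q"
    using b d by (simp add: x y ratfun_subst_Fract q pcompose_mult)
next
  show "ratfun_subst 0 q = 0" "ratfun_subst 1 q = 1"
    using ratfun_subst_to_fract[of 0 q] ratfun_subst_to_fract[of 1 q] by (simp_all add: pcompose_1)
qed

lemma ratfun_char_poly_matrix:
  assumes "N \<in> carrier_mat s s"
  shows "ratfun_X \<cdot>\<^sub>m 1\<^sub>m s - ratfun_mat N = map_mat to_fract (char_poly_matrix N)"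
  using assms by (intro eq_matI)
    (auto simp: ratfun_mat_def char_poly_matrix_def simp flip: to_fract_diff to_fract_uminus)

lemma to_fract_char_poly:
  assumes "N \<in> carrier_mat s s"
  shows "to_fract (char_poly N) = det (ratfun_X \<cdot>\<^sub>m 1\<^sub>m s - ratfun_mat N)"
  unfolding ratfun_char_poly_matrix[OF assms] char_poly_def
  by (rule comm_ring_hom.hom_det[OF comm_ring_hom_to_fract, symmetric])

lemma (in comm_ring_hom) hom_scalar_prod_mult_vec:
  assumes "R \<in> carrier_mat s s"
  shows "hom (vec s (\<lambda>_. 1) \<bullet> (R *\<^sub>v vec s (\<lambda>_. 1))) = vec s (\<lambda>_. 1) \<bullet> (map_mat hom R *\<^sub>v vec s (\<lambda>_. 1))"
  using assms by (simp add: scalar_prod_def hom_sum)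

text \<open>Substituting in every entry of the inverse of \<open>x I - N\<close> gives an inverse of
  \<open>E\<close>, and the sum of its entries is the substituted coronal. This supplies the
  \<open>R\<close> for the Schur complement.\<close>

lemma ratfun_subst_coronal:
  assumes N: "N \<in> carrier_mat s s" and q: "degree q > 0"
  defines "E \<equiv> map_mat (\<lambda>r. ratfun_subst r q) (ratfun_X \<cdot>\<^sub>m 1\<^sub>m s - ratfun_mat N)"
  obtains R where "R \<in> carrier_mat s s" "E * R = 1\<^sub>m s"
    "ratfun_subst (coronal N) q = vec s (\<lambda>_. 1) \<bullet> (R *\<^sub>v vec s (\<lambda>_. 1))"
proof -
  interpret subst: comm_ring_hom "\<lambda>r. ratfun_subst r q"
    by (rule comm_ring_hom_ratfun_subst[OF q])
  let ?B = "ratfun_X \<cdot>\<^sub>m 1\<^sub>m s - ratfun_mat N"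
  have B: "?B \<in> carrier_mat s s" using N by (auto simp: ratfun_mat_def)
  obtain R where R: "mat_inverse ?B = Some R" "R \<in> carrier_mat s s" "?B * R = 1\<^sub>m s"
    using mat_inverse_char[OF N] by auto
  let ?R = "map_mat (\<lambda>r. ratfun_subst r q) R"
  have "E * ?R = 1\<^sub>m s"
    unfolding E_def subst.mat_hom_mult[OF B R(2), symmetric] R(3) by (rule subst.mat_hom_one)
  moreover have "coronal N = vec s (\<lambda>_. 1) \<bullet> (R *\<^sub>v vec s (\<lambda>_. 1))"
    using N R(1) by (simp add: coronal_def Let_def)
  ultimately show ?thesis
    using that[of ?R] R(2) by (simp add: subst.hom_scalar_prod_mult_vec)
qed

text \<open>Substitution commutes with the determinant; this evaluates the factor split off by each
  copy.\<close>

lemma det_ratfun_subst: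
  assumes N: "N \<in> carrier_mat s s" and q: "degree q > 0"
  shows "det (map_mat (\<lambda>r. ratfun_subst r q) (ratfun_X \<cdot>\<^sub>m 1\<^sub>m s - ratfun_mat N))
    = to_fract (char_poly N \<circ>\<^sub>p q)"
  unfolding comm_ring_hom.hom_det[OF comm_ring_hom_ratfun_subst[OF q]]
    to_fract_char_poly[OF N, symmetric] ratfun_subst_to_fract ..

section \<open>Arcs and degrees in the graph with pockets\<close>

lemma out_degree_conv_card:
  "out_degree (with_proj G) u = card {w. (u, w) \<in> parcs G}"
proof -
  have "out_arcs (with_proj G) u = Pair u ` {w. (u, w) \<in> parcs G}"
    by (auto simp: out_arcs_def)
  thus ?thesis by (simp add: out_degree_def card_image inj_on_def)
qed

lemma pocket_graph_arcs:
  assumes "pair_graph H"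
  shows "(Inl a, Inl b) \<in> parcs (pocket_graph F ps H v) \<longleftrightarrow> (a, b) \<in> parcs F"
    and "(Inl a, Inr (j, w)) \<in> parcs (pocket_graph F ps H v) \<longleftrightarrow>
      j < length ps \<and> a = ps ! j \<and> w \<noteq> v \<and> (v, w) \<in> parcs H"
    and "(Inr (i, u), Inl b) \<in> parcs (pocket_graph F ps H v) \<longleftrightarrow>
      i < length ps \<and> b = ps ! i \<and> u \<noteq> v \<and> (u, v) \<in> parcs H"
    and "(Inr (i, u), Inr (j, w)) \<in> parcs (pocket_graph F ps H v) \<longleftrightarrow>
      i < length ps \<and> j = i \<and> u \<noteq> v \<and> w \<noteq> v \<and> (u, w) \<in> parcs H"
proof -
  interpret H: pair_graph H by fact
  \<comment> \<open>Only \<open>v\<close> is sent into \<open>F\<close>, so an arc that a copy added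
    inside \<open>F\<close> would come from a loop at \<open>v\<close>.\<close>
  have "(v, v) \<notin> parcs H" using H.pair_no_loops by fastforce
  thus "(Inl a, Inl b) \<in> parcs (pocket_graph F ps H v) \<longleftrightarrow> (a, b) \<in> parcs F"
    by (auto simp: pocket_graph_def pocket_embed_def split: if_splits)
  show "(Inl a, Inr (j, w)) \<in> parcs (pocket_graph F ps H v) \<longleftrightarrow>
      j < length ps \<and> a = ps ! j \<and> w \<noteq> v \<and> (v, w) \<in> parcs H"
    "(Inr (i, u), Inl b) \<in> parcs (pocket_graph F ps H v) \<longleftrightarrow>
      i < length ps \<and> b = ps ! i \<and> u \<noteq> v \<and> (u, v) \<in> parcs H"
    "(Inr (i, u), Inr (j, w)) \<in> parcs (pocket_graph F ps H v) \<longleftrightarrow>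
      i < length ps \<and> j = i \<and> u \<noteq> v \<and> w \<noteq> v \<and> (u, w) \<in> parcs H"
    by (force simp: pocket_graph_def pocket_embed_def image_iff split: if_splits)+
qed

context
  fixes F :: "'a pair_pre_digraph" and H :: "'b pair_pre_digraph" and v :: 'b and ps :: "'a list"
  assumes F: "pair_graph F" and ps: "distinct ps"
    and H: "pair_graph H" and v: "v \<in> pverts H"
    and deg_v: "out_degree (with_proj H) v = card (pverts H) - 1"
begin

text \<open>The neighbours of \<open>v\<close> lie among the other vertices and are equally many, so
  they are all of them.\<close>

lemma full_degree_arcs: "(v, w) \<in> parcs H \<longleftrightarrow> w \<in> pverts H - {v}"
proof -
  interpret H: pair_graph H by (rule H)
  have "{w. (v, w) \<in> parcs H} \<subseteq> pverts H - {v}"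
    using H.in_arcsD2 H.pair_no_loops by fastforce
  moreover have "card {w. (v, w) \<in> parcs H} = card (pverts H - {v})"
    using deg_v v H.pair_finite_verts by (simp add: out_degree_conv_card)
  ultimately have "{w. (v, w) \<in> parcs H} = pverts H - {v}"
    using H.pair_finite_verts by (intro card_subset_eq) auto
  thus ?thesis by blast
qed

lemma full_degree_arcs': "(w, v) \<in> parcs H \<longleftrightarrow> w \<in> pverts H - {v}"
proof -
  interpret H: pair_graph H by (rule H)
  have "(w, v) \<in> parcs H \<longleftrightarrow> (v, w) \<in> parcs H"
    using H.pair_sym_arcs unfolding symmetric_def with_proj_simps by (metis symD)
  thus ?thesis by (simp add: full_degree_arcs)
qed

text \<open>A pocket vertex also plays the role of \<open>v\<close> in its copy and gains all the
  other vertices of \<open>H\<close> as neighbours.\<close>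

lemma out_degree_pocket_graph_Inl:
  "out_degree (with_proj (pocket_graph F ps H v)) (Inl a) =
     out_degree (with_proj F) a + (if a \<in> set ps then card (pverts H) - 1 else 0)"
proof -
  interpret F: pair_graph F by (rule F)
  interpret H: pair_graph H by (rule H)
  let ?N = "{w. (a, w) \<in> parcs F}"
  have fin: "finite ?N"
    by (rule finite_subset[OF _ F.pair_finite_verts]) (auto dest: F.in_arcsD2)
  have *: "{x. (Inl a, x) \<in> parcs (pocket_graph F ps H v)}
     = Inl ` ?N \<union> Inr ` ({j. j < length ps \<and> ps ! j = a} \<times> (pverts H - {v}))"
    (is "?L = ?R")
  proof (rule Set.set_eqI)
    fix x show "x \<in> ?L \<longleftrightarrow> x \<in> ?R"
    proof (cases x)
      case (Inr p)
      thus ?thesis by (cases p) (auto simp: pocket_graph_arcs[OF H] full_degree_arcs)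
    qed (auto simp: pocket_graph_arcs[OF H])
  qed
  \<comment> \<open>As \<open>ps\<close> is distinct, at most one copy hangs at a given
    vertex.\<close>
  have "card {j. j < length ps \<and> ps ! j = a} = (if a \<in> set ps then 1 else 0)"
  proof (cases "a \<in> set ps")
    case True
    then obtain i where "i < length ps" "ps ! i = a" by (auto simp: in_set_conv_nth)
    hence "{j. j < length ps \<and> ps ! j = a} = {i}"
      using ps by (auto simp: nth_eq_iff_index_eq)
    thus ?thesis using True by simp
  next
    case False
    hence "{j. j < length ps \<and> ps ! j = a} = {}" by auto
    thus ?thesis using False by simp
  qed
  moreover have "card ?R = card ?N + card {j. j < length ps \<and> ps ! j = a} * card (pverts H - {v})"
    using fin H.pair_finite_verts
    by (subst card_Un_disjoint) (auto simp: card_image card_cartesian_product)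
  ultimately show ?thesis
    using v H.pair_finite_verts by (simp add: out_degree_conv_card *)
qed

text \<open>The neighbour \<open>v\<close>, lost in \<open>H - v\<close>, is present in the pocket
  graph as \<open>ps ! i\<close>. This extra 1 is the source of the shift to
  \<open>x - 1\<close>.\<close>

lemma out_degree_pocket_graph_Inr:
  assumes "i < length ps" "w \<in> pverts H" "w \<noteq> v"
  shows "out_degree (with_proj (pocket_graph F ps H v)) (Inr (i, w)) =
     Suc (out_degree (pre_digraph.del_vert (with_proj H) v) w)"
proof -
  interpret H: pair_graph H by (rule H)
  let ?N = "{u. u \<noteq> v \<and> (w, u) \<in> parcs H}"
  have fin: "finite ?N"
    by (rule finite_subset[OF _ H.pair_finite_verts]) (auto dest: H.in_arcsD2)
  have "{x. (Inr (i, w), x) \<in> parcs (pocket_graph F ps H v)}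
     = insert (Inl (ps ! i)) ((\<lambda>u. Inr (i, u)) ` ?N)" (is "?L = ?R")
  proof (rule Set.set_eqI)
    fix x show "x \<in> ?L \<longleftrightarrow> x \<in> ?R"
    proof (cases x)
      case (Inr p)
      thus ?thesis using assms by (cases p) (auto simp: pocket_graph_arcs[OF H])
    qed (use assms in \<open>auto simp: pocket_graph_arcs[OF H] full_degree_arcs'\<close>)
  qed
  moreover have "card ?R = Suc (card ?N)"
    using fin by (subst card_insert_disjoint) (auto simp: card_image inj_on_def)
  moreover have "out_arcs (pre_digraph.del_vert (with_proj H) v) w = Pair w ` ?N"
    using assms by (auto simp: out_arcs_def pre_digraph.del_vert_def)
  hence "out_degree (pre_digraph.del_vert (with_proj H) v) w = card ?N"
    by (simp add: out_degree_def card_image inj_on_def)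
  ultimately show ?thesis by (simp add: out_degree_conv_card)
qed

end

section \<open>Signless Laplacians over the rational functions\<close>

text \<open>The entry of \<open>x I - Q(X)\<close> at a pair of vertices.\<close>

definition ratfun_kernel :: "('a, 'b) pre_digraph \<Rightarrow> 'a \<Rightarrow> 'a \<Rightarrow> real poly fract" where
  "ratfun_kernel X u w = (if u = w then ratfun_X - of_nat (out_degree X u) else 0)
     - (if u \<rightarrow>\<^bsub>X\<^esub> w then 1 else 0)"

lemma to_fract_const_of_nat: "to_fract [:real n:] = of_nat n"
proof (induction n)
  case (Suc n)
  have "[:real (Suc n):] = 1 + [:real n:]" by (simp add: one_pCons)
  thus ?case using Suc.IH by (simp only: to_fract_add to_fract_1 of_nat_Suc)
qed simp

text \<open>Without repetitions in \<open>xs\<close>, equal vertices are equal positions, so both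
  diagonals agree.\<close>

lemma ratfun_signless_laplacian:
  assumes "distinct xs"
  shows "ratfun_X \<cdot>\<^sub>m 1\<^sub>m (length xs) - ratfun_mat (signless_laplacian X xs)
    = kernel_mat (ratfun_kernel X) xs xs"
proof (rule eq_matI)
  fix i j assume "i < dim_row (kernel_mat (ratfun_kernel X) xs xs)"
    "j < dim_col (kernel_mat (ratfun_kernel X) xs xs)"
  \<comment> \<open>Splits the constant for degree plus adjacency so that \<open>to_fract\<close>
    distributes; \<open>add_pCons\<close> would merge it again.\<close>
  moreover have "[:a + b:] = [:a:] + [:b:]" for a b :: real by simp
  ultimately show "(ratfun_X \<cdot>\<^sub>m 1\<^sub>m (length xs) - ratfun_mat (signless_laplacian X xs)) $$ (i, j)
      = kernel_mat (ratfun_kernel X) xs xs $$ (i, j)"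
    using assms
    by (auto simp: ratfun_mat_def signless_laplacian_def degree_matrix_def adjacency_matrix_def
      ratfun_kernel_def nth_eq_iff_index_eq to_fract_const_of_nat one_pCons[symmetric]
      simp del: add_pCons)
qed (auto simp: ratfun_mat_def signless_laplacian_def degree_matrix_def adjacency_matrix_def)

lemma signless_laplacian_carrier: "signless_laplacian X xs \<in> carrier_mat (length xs) (length xs)"
  by (simp add: signless_laplacian_def degree_matrix_def adjacency_matrix_def)

lemma to_fract_char_poly_signless_laplacian:
  assumes "distinct xs"
  shows "to_fract (char_poly (signless_laplacian X xs)) = det (kernel_mat (ratfun_kernel X) xs xs)"
  using to_fract_char_poly[OF signless_laplacian_carrier, of X xs]
  by (simp add: ratfun_signless_laplacian[OF assms])

text \<open>Two degree changes account for the shape: \<open>m - 1\<close> more at each pocket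
  vertex, where \<open>m\<close> is the order of \<open>H\<close>, and one more at each copied
  vertex, which is the substitution of \<open>x - 1\<close>. The coupling entries are
  \<open>- 1\<close> as \<open>v\<close> is adjacent to all other vertices.\<close>

lemma ratfun_kernel_pocket_graph:
  assumes F: "pair_graph F" and ps: "distinct ps"
    and H: "pair_graph H" and v: "v \<in> pverts H"
    and deg_v: "out_degree (with_proj H) v = card (pverts H) - 1"
    and x: "x \<in> Inl ` pverts F \<union> Inr ` ({..<length ps} \<times> (pverts H - {v}))"
    and y: "y \<in> Inl ` pverts F \<union> Inr ` ({..<length ps} \<times> (pverts H - {v}))"
  shows "ratfun_kernel (with_proj (pocket_graph F ps H v)) x y =
    pocket_kernel
      (\<lambda>a b. ratfun_kernel (with_proj F) a b
         - (if a = b \<and> a \<in> set ps then of_nat (card (pverts H) - 1) else 0))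
      (\<lambda>u w. ratfun_subst (ratfun_kernel (pre_digraph.del_vert (with_proj H) v) u w) [:-1, 1:])
      (\<lambda>i. ps ! i) x y"
proof -
  interpret subst: comm_ring_hom "\<lambda>r. ratfun_subst r [:-1, 1:]"
    by (rule comm_ring_hom_ratfun_subst) simp
  have X: "ratfun_subst ratfun_X [:-1, 1:] = ratfun_X - 1"
    by (simp add: ratfun_subst_to_fract flip: to_fract_1 to_fract_diff) (simp add: one_pCons)
  have of_nat: "ratfun_subst (of_nat d) [:-1, 1:] = of_nat d" for d
    by (rule subst.hom_of_nat)
  have arc: "(u, w) \<in> arcs_ends (pre_digraph.del_vert (with_proj H) v)
      \<longleftrightarrow> u \<noteq> v \<and> w \<noteq> v \<and> (u, w) \<in> parcs H" for u w
    by (force simp: arcs_ends_conv pre_digraph.del_vert_def)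
  note degs = out_degree_pocket_graph_Inl[OF F ps H v deg_v] out_degree_pocket_graph_Inr[OF F ps H v deg_v]
  note arcs = pocket_graph_arcs[OF H] full_degree_arcs[OF F ps H v deg_v] full_degree_arcs'[OF F ps H v deg_v] arc
  \<comment> \<open>The shift affects only the variable on the diagonal; degrees and adjacency
    entries are constants.\<close>
  have subst: "ratfun_subst (ratfun_kernel (pre_digraph.del_vert (with_proj H) v) u w) [:-1, 1:]
      = (if u = w then ratfun_X - 1 - of_nat (out_degree (pre_digraph.del_vert (with_proj H) v) u) else 0)
        - (if u \<noteq> v \<and> w \<noteq> v \<and> (u, w) \<in> parcs H then 1 else 0)" for u w
    unfolding ratfun_kernel_def arc subst.hom_minus by (auto simp: X of_nat subst.hom_minus)
  from x y show ?thesis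
    unfolding subst by (auto simp: ratfun_kernel_def degs arcs split: if_splits)
qed

section \<open>The characteristic polynomial of the graph with pockets\<close>

theorem proposition3p5:
  fixes F :: "'a pair_pre_digraph" and H :: "'b pair_pre_digraph" and v :: 'b
    and H1 :: "('b, 'b \<times> 'b) pre_digraph" and G :: "('a + nat \<times> 'b) pair_pre_digraph"
    and ps fs :: "'a list" and hs :: "'b list" and gs :: "('a + nat \<times> 'b) list"
    and n k m :: nat and M :: "real poly fract mat"
  assumes "pair_graph F" and "card (pverts F) = n" and "n \<ge> 1"
    and "distinct ps" and "length ps = k" and "set ps \<subseteq> pverts F"
    and "pair_graph H" and "card (pverts H) = m" and "m \<ge> 2"
    and "v \<in> pverts H" and "out_degree (with_proj H) v = m - 1"
    and "H1 = pre_digraph.del_vert (with_proj H) v"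
    and "G = pocket_graph F ps H v"
    and "vertex_order (with_proj F) fs" and "take k fs = ps"
    and "vertex_order H1 hs"
    and "vertex_order (with_proj G) gs"
    and "M = ratfun_mat (signless_laplacian (with_proj F) fs)
           + (of_nat (m - 1) + ratfun_subst (coronal (signless_laplacian H1 hs)) [:-1, 1:])
             \<cdot>\<^sub>m four_block_mat (1\<^sub>m k) (0\<^sub>m k (n - k)) (0\<^sub>m (n - k) k) (0\<^sub>m (n - k) (n - k))"
  shows "to_fract (char_poly (signless_laplacian (with_proj G) gs))
       = to_fract (char_poly (signless_laplacian H1 hs) \<circ>\<^sub>p [:-1, 1:]) ^ k
         * det (ratfun_X \<cdot>\<^sub>m 1\<^sub>m n - M)"
proof -
  let ?q = "[:-1, 1:] :: real poly"
  have q: "degree ?q > 0" by simp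
  have fs: "distinct fs" "set fs = pverts F" "length fs = n"
    using assms(2,14) distinct_card[of fs] by (auto simp: vertex_order_def)
  have hs: "distinct hs" "set hs = pverts H - {v}"
    using assms(12,16) by (auto simp: vertex_order_def pre_digraph.del_vert_def)
  have gs: "distinct gs" "set gs = pverts G"
    using assms(17) by (auto simp: vertex_order_def)
  have deg_v: "out_degree (with_proj H) v = card (pverts H) - 1"
    using assms(8,11) by simp
  \<comment> \<open>Subtraction on naturals truncates; \<open>k \<le> n\<close> ensures that the
    block matrix in \<open>M\<close> has order \<open>n\<close>.\<close>
  have k: "k \<le> n"
  proof -
    have "length ps = min (length fs) k" using assms(15) by (metis length_take)
    thus ?thesis using assms(5) fs(3) by simp
  qed
  have dimM: "dim_row M = n" "dim_col M = n"
    using k by (simp_all add: assms(18) four_block_mat_def)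
  let ?N = "signless_laplacian H1 hs"
  let ?\<Gamma> = "ratfun_subst (coronal ?N) ?q"
  define \<alpha> where "\<alpha> a b = ratfun_kernel (with_proj F) a b - (if a = b \<and> a \<in> set ps then of_nat (m - 1) else 0)" for a b
  define \<beta> where "\<beta> u w = ratfun_subst (ratfun_kernel H1 u w) ?q" for u w
  let ?o = "pocket_order fs hs k"
  have \<beta>: "kernel_mat \<beta> hs hs = map_mat (\<lambda>r. ratfun_subst r ?q)
      (ratfun_X \<cdot>\<^sub>m 1\<^sub>m (length hs) - ratfun_mat ?N)"
    unfolding ratfun_signless_laplacian[OF hs(1)] by (rule eq_matI) (auto simp: \<beta>_def)
  obtain R where R: "R \<in> carrier_mat (length hs) (length hs)"
      "kernel_mat \<beta> hs hs * R = 1\<^sub>m (length hs)"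
      "?\<Gamma> = vec (length hs) (\<lambda>_. 1) \<bullet> (R *\<^sub>v vec (length hs) (\<lambda>_. 1))"
    using ratfun_subst_coronal[OF signless_laplacian_carrier q] unfolding \<beta> by blast
  have set_o: "set ?o = Inl ` pverts F \<union> Inr ` ({..<length ps} \<times> (pverts H - {v}))"
    using assms(5) fs hs by (simp add: set_pocket_order)
  \<comment> \<open>Each copy of \<open>v\<close> is a pocket vertex already in \<open>F\<close>, so
    a copy adds only the vertices of \<open>H - v\<close>.\<close>
  have "pverts G = set ?o"
    unfolding set_o using assms(6,10,13) by (fastforce simp: pocket_graph_def pocket_embed_def)
  hence "mset gs = mset ?o"
    using gs distinct_pocket_order[OF fs(1) hs(1)] by (metis set_eq_iff_mset_eq_distinct)
  hence "det (kernel_mat (ratfun_kernel (with_proj G)) gs gs)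
      = det (kernel_mat (ratfun_kernel (with_proj G)) ?o ?o)"
    by (rule det_kernel_mat_mset_cong)
  also have "kernel_mat (ratfun_kernel (with_proj G)) ?o ?o
      = kernel_mat (pocket_kernel \<alpha> \<beta> (\<lambda>i. ps ! i)) ?o ?o"
    unfolding \<alpha>_def \<beta>_def assms(12,13) assms(8)[symmetric]
    using ratfun_kernel_pocket_graph[OF assms(1,4,7,10) deg_v]
    by (intro kernel_mat_cong) (simp only: set_o)
  also have "det \<dots> = det (kernel_mat \<beta> hs hs) ^ k *
      det (kernel_mat (\<lambda>a b. \<alpha> a b - (\<Sum>i<k. if a = ps ! i \<and> b = ps ! i then ?\<Gamma> else 0)) fs fs)"
    unfolding R(3) by (rule det_pocket_kernel[OF R(1,2)])
  also have "det (kernel_mat \<beta> hs hs) = to_fract (char_poly ?N \<circ>\<^sub>p ?q)"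
    unfolding \<beta> by (rule det_ratfun_subst[OF signless_laplacian_carrier q])
  \<comment> \<open>The degree increase \<open>m - 1\<close> inside \<open>\<alpha>\<close> and the
    subtracted coronal combine to the coefficient of the block \<open>I_k\<close> in
    \<open>M\<close>.\<close>
  also have "kernel_mat (\<lambda>a b. \<alpha> a b - (\<Sum>i<k. if a = ps ! i \<and> b = ps ! i then ?\<Gamma> else 0)) fs fs
      = ratfun_X \<cdot>\<^sub>m 1\<^sub>m n - M"
  proof (rule eq_matI)
    fix i j assume "i < dim_row (ratfun_X \<cdot>\<^sub>m 1\<^sub>m n - M)" "j < dim_col (ratfun_X \<cdot>\<^sub>m 1\<^sub>m n - M)"
    hence ij: "i < n" "j < n" using dimM by auto
    have ps_nth: "ps ! l = fs ! l" if "l < k" for l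
      using that assms(15) by (metis nth_take)
    \<comment> \<open>The pocket vertices occupy exactly the first \<open>k\<close> positions of
      \<open>fs\<close>.\<close>
    have mem: "fs ! i \<in> set ps \<longleftrightarrow> i < k"
    proof -
      have "fs ! i \<in> set ps \<longleftrightarrow> (\<exists>l<k. fs ! l = fs ! i)"
        using assms(5) ps_nth by (auto simp: in_set_conv_nth)
      also have "\<dots> \<longleftrightarrow> i < k"
        using ij k fs by (auto simp: nth_eq_iff_index_eq)
      finally show ?thesis .
    qed
    \<comment> \<open>Distinctness of \<open>fs\<close> leaves at most the summand with
      \<open>l = i\<close>, and only on the diagonal.\<close>
    have "(\<Sum>l<k. if fs ! i = ps ! l \<and> fs ! j = ps ! l then ?\<Gamma> else 0)
        = (\<Sum>l<k. if l = i then (if i = j then ?\<Gamma> else 0) else 0)"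
      using ij k fs by (intro sum.cong) (auto simp: ps_nth nth_eq_iff_index_eq)
    also have "\<dots> = (if i = j \<and> i < k then ?\<Gamma> else 0)"
      by simp
    finally have sum: "(\<Sum>l<k. if fs ! i = ps ! l \<and> fs ! j = ps ! l then ?\<Gamma> else 0)
        = (if i = j \<and> i < k then ?\<Gamma> else 0)" .
    have eq: "fs ! i = fs ! j \<longleftrightarrow> i = j" using ij fs by (simp add: nth_eq_iff_index_eq)
    have "ratfun_kernel (with_proj F) (fs ! i) (fs ! j)
        = (ratfun_X \<cdot>\<^sub>m 1\<^sub>m n - ratfun_mat (signless_laplacian (with_proj F) fs)) $$ (i, j)"
      using ratfun_signless_laplacian[OF fs(1), of "with_proj F"] ij fs by simp
    moreover have "four_block_mat (1\<^sub>m k) (0\<^sub>m k (n - k)) (0\<^sub>m (n - k) k) (0\<^sub>m (n - k) (n - k)) $$ (i, j)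
        = (if i = j \<and> i < k then 1 else 0 :: real poly fract)"
      using ij k by auto
    ultimately show "kernel_mat (\<lambda>a b. \<alpha> a b - (\<Sum>i<k. if a = ps ! i \<and> b = ps ! i then ?\<Gamma> else 0)) fs fs $$ (i, j)
        = (ratfun_X \<cdot>\<^sub>m 1\<^sub>m n - M) $$ (i, j)"
      using ij k fs signless_laplacian_carrier[of "with_proj F" fs]
      by (auto simp: assms(18) sum \<alpha>_def mem eq ratfun_mat_def)
  qed (simp_all add: dimM fs(3))
  finally show ?thesis
    unfolding to_fract_char_poly_signless_laplacian[OF gs(1)] .
qed

end
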